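(* If $m$ is an even perfect number, then $n = 2m$ satisfies the congruence $$\binom{2n}{n} \equiv 2^n \pmod n.$$
   Context: A perfect number is a positive integer equal to the sum of its positive proper divisors. *)

theory Defs
  imports "HOL-Number_Theory.Number_Theory"
begin

definition perfect_number :: "nat \<Rightarrow> bool" where
  "perfect_number m \<longleftrightarrow> m > 0 \<and> \<Sum>{d. d dvd m \<and> d \<noteq> m} = m"

end

(* By Euclid-Euler, m = 2^(p-1) * q with q = 2^p - 1 prime, so n = 2^p * q. Modulo 2^p both sides
   vanish: the 2-adic valuation v of C(2k, k) does not change when k is doubled, so it equals 1
   for k = q + 1 = 2^p, and (q + 1) C(2q + 2, q + 1) = 2 (2q + 1) C(2q, q) then gives
   v (C(2n, n)) = v (C(2q, q)) = p. Modulo q both sides are 4: C(2n, n) is congruent to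
   C(2q + 2, q + 1), to which the same recurrence applies, and 2^n = (2^q)^(q+1) to 2^(q+1),
   hence to 4. *)
theory Submission
  imports Defs
begin

text \<open>By coprimality each divisor of \<open>a * b\<close> is a product of a divisor of
  \<open>a\<close> and one of \<open>b\<close> in exactly one way, so the sum becomes a double sum
  that factors.\<close>

lemma sum_divisors_mult_coprime:
  fixes a b :: nat
  assumes "coprime a b"
  shows "\<Sum>{d. d dvd a * b} = \<Sum>{d. d dvd a} * \<Sum>{d. d dvd b}"
proof -
  let ?f = "\<lambda>(x, y). x * y :: nat"
  \<comment> \<open>Used in both directions, this makes the first factors divide each other;
    antisymmetry then gives injectivity.\<close>
  have dvd: "x dvd x'" if "x dvd a" "y' dvd b" "x * y = x' * y'" for x y x' y'
  proof -
    have "coprime x y'"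
      using assms that(1,2) coprime_divisors by blast
    moreover have "x dvd x' * y'"
      using that(3) by (metis dvd_triv_left)
    ultimately show ?thesis
      by (simp add: coprime_dvd_mult_left_iff)
  qed
  have "inj_on ?f ({d. d dvd a} \<times> {d. d dvd b})"
  proof (rule inj_onI, clarsimp)
    fix x y x' y'
    assume xy: "x dvd a" "y dvd b" "x' dvd a" "y' dvd b" "x * y = x' * y'"
    have "x = x'"
      using dvd[of x y' y x'] dvd[of x' y y' x] xy by (simp add: dvd_antisym)
    moreover have "y = y'"
    proof -
      have "coprime y x'" "coprime y' x"
        using assms xy coprime_divisors coprime_commute by blast+
      moreover have "y dvd x' * y'" "y' dvd x * y"
        using xy(5) by (metis dvd_triv_right)+
      ultimately show ?thesis
        by (simp add: coprime_dvd_mult_right_iff dvd_antisym)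
    qed
    ultimately show "x = x' \<and> y = y'" ..
  qed
  moreover have "{d. d dvd a * b} = ?f ` ({d. d dvd a} \<times> {d. d dvd b})"
    by (auto dest!: division_decomp intro: mult_dvd_mono)
  ultimately have "\<Sum>{d. d dvd a * b} = (\<Sum>z\<in>{d. d dvd a} \<times> {d. d dvd b}. ?f z)"
    by (simp add: sum.reindex)
  also have "\<dots> = \<Sum>{d. d dvd a} * \<Sum>{d. d dvd b}"
    by (simp add: sum_product sum.cartesian_product)
  finally show ?thesis .
qed

lemma sum_divisors_power_two: "\<Sum>{d. d dvd (2::nat) ^ k} = 2 ^ Suc k - 1"
proof -
  have "{d. d dvd (2::nat) ^ k} = (\<lambda>i. 2 ^ i) ` {..k}"
    by (auto simp: divides_primepow_nat)
  then have "\<Sum>{d. d dvd (2::nat) ^ k} = (\<Sum>i\<le>k. 2 ^ i)"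
    by (simp add: sum.reindex inj_on_def)
  also have "\<dots> = 2 ^ Suc k - 1"
    by (induction k) auto
  finally show ?thesis .
qed

text \<open>Euler's argument: write \<open>m = 2 ^ k * t\<close> with \<open>t\<close> odd and
  \<open>q = 2 ^ Suc k - 1\<close>. Multiplicativity of the divisor sum forces
  \<open>t = q * s\<close> with divisor sum \<open>t + s\<close>. Since \<open>s\<close> and
  \<open>t\<close> alone already reach that sum, they are the only divisors, so \<open>s = 1\<close>
  and \<open>t = q\<close> is prime.\<close>

lemma even_perfect_numberE:
  assumes "perfect_number m" and "even m"
  obtains p where "p \<ge> 2" and "prime (2 ^ p - 1 :: nat)" and "m = 2 ^ (p - 1) * (2 ^ p - 1)"
proof -
  have m: "m > 0" and sum_proper: "\<Sum>{d. d dvd m \<and> d \<noteq> m} = m"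
    using assms(1) by (auto simp: perfect_number_def)
  define k where "k = multiplicity 2 m"
  obtain t where t: "m = 2 ^ k * t" "odd t"
    using multiplicity_decompose'[of m 2] m unfolding k_def by auto
  have "k \<ge> 1"
    using t assms(2) by (cases k) auto
  define q where "q = (2::nat) ^ Suc k - 1"
  \<comment> \<open>Evenness of \<open>m\<close> enters here: \<open>q\<close> is at least 3, hence
    \<open>s\<close> and \<open>t = q * s\<close> are distinct.\<close>
  have "(2::nat) ^ Suc k \<ge> 2 ^ 2"
    using \<open>k \<ge> 1\<close> by (intro power_increasing) auto
  then have q: "2 ^ Suc k = Suc q" "q \<ge> 3"
    unfolding q_def by auto
  have t0: "t > 0"
    using t m by (cases t) auto
  have "\<Sum>{d. d dvd m} = m + \<Sum>{d. d dvd m \<and> d \<noteq> m}"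
  proof -
    have "{d. d dvd m} = insert m {d. d dvd m \<and> d \<noteq> m}"
      by auto
    then show ?thesis
      using m by (subst \<open>{d. d dvd m} = _\<close>, subst sum.insert) auto
  qed
  \<comment> \<open>The divisor sum of \<open>m\<close> is \<open>2 * m\<close>, that is
    \<open>2 ^ Suc k * t\<close>.\<close>
  then have "q * \<Sum>{d. d dvd t} = Suc q * t"
    using sum_divisors_mult_coprime[of "2 ^ k" t] t sum_proper sum_divisors_power_two[of k]
    by (simp add: q_def flip: q(1))
  moreover from this have "q dvd t"
    by (metis coprime_Suc_right_nat coprime_dvd_mult_right_iff dvd_triv_left)
  then obtain s where s: "t = q * s" ..
  ultimately have "q * \<Sum>{d. d dvd t} = q * (t + s)"
    by (simp add: algebra_simps)
  then have "\<Sum>{d. d dvd t} = t + s"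
    using q(2) by simp
  have "s > 0" "s < t"
    using s t0 q(2) by auto
  have divisors: "{d. d dvd t} = {s, t}"
  proof (rule ccontr)
    assume "\<not> ?thesis"
    moreover have "{s, t} \<subseteq> {d. d dvd t}"
      using s by auto
    ultimately obtain d where d: "d dvd t" "d \<noteq> s" "d \<noteq> t"
      by blast
    have "d > 0"
      using d t0 by (metis dvd_0_left_iff gr0I)
    have "\<Sum>{d, s, t} \<le> \<Sum>{d. d dvd t}"
      using d s t0 by (intro sum_mono2) auto
    then show False
      using d \<open>s < t\<close> \<open>d > 0\<close> \<open>\<Sum>{d. d dvd t} = t + s\<close> by simp
  qed
  then have "s = 1"
    using \<open>s < t\<close> \<open>s > 0\<close> by (metis insert_iff less_one mem_Collect_eq neq0_conv one_dvd singletonD)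
  then have "prime q"
    using divisors q(2) s by (auto simp: prime_nat_iff)
  then show thesis
    using \<open>k \<ge> 1\<close> t s \<open>s = 1\<close> that[of "Suc k"] by (simp add: q_def)
qed

lemma multiplicity_two_fact_double:
  "multiplicity 2 (fact (2 * k) :: nat) = k + multiplicity 2 (fact k :: nat)"
proof (induction k)
  case (Suc k)
  \<comment> \<open>The factor \<open>Suc k\<close> is also what \<open>fact k\<close> gains, and
    \<open>Suc (2 * k)\<close> is odd, so one extra 2 remains.\<close>
  have "(fact (2 * Suc k) :: nat) = 2 * (Suc k * (Suc (2 * k) * fact (2 * k)))"
    by (simp add: algebra_simps)
  moreover have "multiplicity 2 (Suc (2 * k)) = 0"
    by (rule not_dvd_imp_multiplicity_0) simp
  ultimately show ?case
    using Suc.IH by (simp add: prime_elem_multiplicity_mult_distrib del: mult_Suc mult_Suc_right)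
qed simp

text \<open>Compare valuations in (2k)! = k! k! C(2k, k). The additive form avoids truncated
  subtraction.\<close>

lemma multiplicity_two_central_binomial:
  "multiplicity 2 ((2 * k) choose k) + multiplicity 2 (fact k :: nat) = k"
proof -
  have "fact k * (fact k * ((2 * k) choose k)) = (fact (2 * k) :: nat)"
    using binomial_fact_lemma[of k "2 * k"] by (simp add: mult_2 algebra_simps)
  then have "multiplicity 2 (fact k * (fact k * ((2 * k) choose k))) = k + multiplicity 2 (fact k :: nat)"
    using multiplicity_two_fact_double by simp
  then show ?thesis
    by (simp add: prime_elem_multiplicity_mult_distrib)
qed

lemma multiplicity_two_central_binomial_double:
  "multiplicity 2 ((2 * (2 * k)) choose (2 * k)) = multiplicity 2 ((2 * k) choose k)"
  using multiplicity_two_central_binomial[of k] multiplicity_two_central_binomial[of "2 * k"]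
    multiplicity_two_fact_double[of k] by simp

lemma multiplicity_two_central_binomial_power_mult:
  "multiplicity 2 ((2 * (2 ^ i * k)) choose (2 ^ i * k)) = multiplicity 2 ((2 * k) choose k)"
proof (induction i)
  case (Suc i)
  then show ?case
    using multiplicity_two_central_binomial_double[of "2 ^ i * k"] by (simp add: mult.assoc)
qed simp

text \<open>Absorption is applied twice, with the symmetry C(2k+1, k) = C(2k+1, k+1) in between.
  Being free of division, the identity suits both valuations and congruences.\<close>

lemma central_binomial_Suc:
  "Suc k * ((2 * Suc k) choose Suc k) = 2 * Suc (2 * k) * ((2 * k) choose k)"
proof -
  have "Suc k * ((2 * Suc k) choose Suc k) = 2 * (Suc k * (Suc (2 * k) choose k))"
    using Suc_times_binomial_eq[of "Suc (2 * k)" k]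
    by (simp add: algebra_simps del: binomial_Suc_Suc)
  also have "Suc k * (Suc (2 * k) choose k) = Suc k * (Suc (2 * k) choose Suc k)"
    using binomial_symmetric[of k "Suc (2 * k)"] by (simp add: Suc_diff_le del: binomial_Suc_Suc)
  also have "\<dots> = Suc (2 * k) * ((2 * k) choose k)"
    using Suc_times_binomial_eq[of "2 * k" k] by (simp only: mult.commute)
  finally show ?thesis
    by (simp only: mult.assoc)
qed

lemma multiplicity_two_central_binomial_mersenne:
  "multiplicity 2 ((2 * (2 ^ p - 1)) choose (2 ^ p - 1)) = p"
proof -
  define q where "q = (2::nat) ^ p - 1"
  have q: "Suc q = 2 ^ p"
    by (simp add: q_def)
  have "multiplicity 2 ((2 * Suc q) choose Suc q) = 1"
    using multiplicity_two_central_binomial_power_mult[of p 1] q by simp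
  moreover have "multiplicity 2 (Suc q) = p"
    by (simp add: q)
  moreover have "multiplicity 2 (Suc (2 * q)) = 0"
    by (rule not_dvd_imp_multiplicity_0) simp
  \<comment> \<open>Valuations in the recurrence: p + 1 on the left, 1 + 0 + v on the right.\<close>
  moreover have "multiplicity 2 (Suc q * ((2 * Suc q) choose Suc q))
      = multiplicity 2 (2 * (Suc (2 * q) * ((2 * q) choose q)))"
    using central_binomial_Suc[of q] by (simp only: mult.assoc)
  ultimately have "multiplicity 2 ((2 * q) choose q) = p"
    by (simp add: prime_elem_multiplicity_mult_distrib del: mult_Suc mult_Suc_right binomial_Suc_Suc)
  then show ?thesis
    by (simp only: q_def)
qed

text \<open>Vandermonde splits off \<open>q\<close> of the \<open>q * Suc a\<close> elements. The
  inner terms contain \<open>q choose j\<close> with 0 < j < q and vanish modulo \<open>q\<close>;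
  the two outer terms reproduce Pascal's rule.\<close>

lemma binomial_mult_prime_cong:
  fixes q :: nat
  assumes "prime q"
  shows "[(q * a) choose (q * b) = a choose b] (mod q)"
proof (induction a arbitrary: b)
  case 0
  then show ?case
    using prime_gt_0_nat[OF assms] by (cases b) (auto simp: binomial_eq_0)
next
  case (Suc a)
  show ?case
  proof (cases b)
    case (Suc c)
    have "q > 0"
      using assms by (rule prime_gt_0_nat)
    let ?f = "\<lambda>j. (q choose j) * ((q * a) choose (q * b - j))"
    have "[(\<Sum>j\<in>{0<..<q}. ?f j) = 0] (mod q)"
      unfolding cong_0_iff using assms
      by (intro dvd_sum dvd_mult2 dvd_choose_prime) auto
    moreover have "(\<Sum>j\<le>q. ?f j) = ?f 0 + (\<Sum>j\<in>{0<..<q}. ?f j) + ?f q"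
    proof -
      have "{..q} = insert 0 (insert q {0<..<q})"
        using \<open>q > 0\<close> by auto
      then show ?thesis
        using \<open>q > 0\<close> by simp
    qed
    moreover have "(q * Suc a) choose (q * b) = (\<Sum>j\<le>q. ?f j)"
    proof -
      \<comment> \<open>As \<open>b\<close> is positive, \<open>q \<le> q * b\<close>; beyond
        \<open>q\<close> the factor \<open>q choose j\<close> is 0.\<close>
      have "(\<Sum>j\<le>q * b. ?f j) = (\<Sum>j\<le>q. ?f j)"
        using Suc by (intro sum.mono_neutral_right) auto
      then show ?thesis
        using vandermonde[of q "q * a" "q * b"] by simp
    qed
    ultimately have "[(q * Suc a) choose (q * b) = ?f 0 + 0 + ?f q] (mod q)"
      by (simp only:) (intro cong_add cong_refl)
    also have "?f 0 + 0 + ?f q = ((q * a) choose (q * Suc c)) + ((q * a) choose (q * c))"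
      using Suc by simp
    also have "[\<dots> = (a choose Suc c) + (a choose c)] (mod q)"
      by (intro cong_add Suc.IH)
    finally show ?thesis
      using Suc by (simp add: add.commute)
  qed simp
qed

theorem theorem2p2:
  fixes m n :: nat
  assumes "perfect_number m" and "even m" and "n = 2 * m"
  shows "[(2 * n) choose n = 2 ^ n] (mod n)"
proof -
  obtain p where p: "p \<ge> 2" "prime (2 ^ p - 1 :: nat)" "m = 2 ^ (p - 1) * (2 ^ p - 1)"
    using even_perfect_numberE assms(1,2) .
  define q where "q = (2::nat) ^ p - 1"
  have q: "2 ^ p = Suc q"
    by (simp add: q_def)
  have "prime q"
    using p(2) by (simp add: q_def)
  have n: "n = 2 ^ p * q"
    using p(1,3) assms(3) by (cases p) (simp_all add: q_def)
  have "[(2 * n) choose n = 2 ^ n] (mod 2 ^ p)"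
  proof -
    have "multiplicity 2 ((2 * n) choose n) = p"
      using multiplicity_two_central_binomial_power_mult[of p q]
        multiplicity_two_central_binomial_mersenne[of p] by (simp add: n q_def)
    then have "2 ^ p dvd (2 * n) choose n"
      using multiplicity_dvd[of 2 "(2 * n) choose n"] by simp
    moreover have "p \<le> n"
    proof -
      have "p \<le> 2 ^ p"
        using less_exp[of p] by simp
      also have "\<dots> \<le> n"
        using prime_gt_0_nat[OF \<open>prime q\<close>] by (simp add: n)
      finally show ?thesis .
    qed
    then have "(2::nat) ^ p dvd 2 ^ n"
      by (rule le_imp_power_dvd)
    ultimately show ?thesis
      by (metis cong_0_iff cong_sym cong_trans)
  qed
  moreover have "[(2 * n) choose n = 2 ^ n] (mod q)"
  proof -
    have "odd q"
      using p(1) by (simp add: q_def)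
    then have "\<not> q dvd 2"
      using \<open>prime q\<close> by (metis primes_dvd_imp_eq two_is_prime_nat even_numeral)
    then have "[2 ^ (q - 1) * 2 = 1 * 2] (mod q)"
      by (intro cong_mult fermat_theorem \<open>prime q\<close> cong_refl)
    then have fermat: "[2 ^ q = 2] (mod q)"
      using prime_gt_0_nat[OF \<open>prime q\<close>] by (simp add: power_eq_if mult.commute)
    \<comment> \<open>Since \<open>2 ^ p = Suc q\<close>, \<open>n\<close> is
      \<open>q * Suc q\<close>, and a factor \<open>q\<close> can be removed from both
      entries.\<close>
    have "[(2 * n) choose n = (2 * Suc q) choose Suc q] (mod q)"
      using binomial_mult_prime_cong[OF \<open>prime q\<close>, of "2 * Suc q" "Suc q"]
      by (simp add: n q mult_ac del: binomial_Suc_Suc mult_Suc mult_Suc_right)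
    \<comment> \<open>Inserting \<open>Suc q\<close>, which is 1 modulo \<open>q\<close>, makes the
      recurrence applicable without inverses.\<close>
    also have "[1 * ((2 * Suc q) choose Suc q) = Suc q * ((2 * Suc q) choose Suc q)] (mod q)"
      by (intro cong_mult cong_refl) (metis cong_def mod_add_self2 plus_1_eq_Suc)
    then have "[(2 * Suc q) choose Suc q = Suc q * ((2 * Suc q) choose Suc q)] (mod q)"
      by (simp only: mult_1)
    also have "Suc q * ((2 * Suc q) choose Suc q) = 2 * Suc (2 * q) * ((2 * q) choose q)"
      by (rule central_binomial_Suc)
    also have "[\<dots> = 2 * 1 * 2] (mod q)"
    proof (intro cong_mult cong_refl)
      show "[Suc (2 * q) = 1] (mod q)"
        by (metis cong_def mod_mult_self1 plus_1_eq_Suc)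
      show "[(2 * q) choose q = 2] (mod q)"
        using binomial_mult_prime_cong[OF \<open>prime q\<close>, of 2 1] by (simp add: mult.commute)
    qed
    \<comment> \<open>Fermat is read backwards twice: 4 becomes \<open>2 ^ Suc q\<close>, and then
      each base 2 is replaced by \<open>2 ^ q\<close>, which gives the exponent
      \<open>q * Suc q = n\<close>.\<close>
    also have "[2 * 1 * 2 = 2 ^ q * 2] (mod q)"
      using cong_mult[OF cong_sym[OF fermat] cong_refl[of 2]] by simp
    also have "2 ^ q * 2 = (2::nat) ^ Suc q"
      by simp
    also have "[2 ^ Suc q = (2 ^ q) ^ Suc q] (mod q)"
      by (rule cong_pow[OF cong_sym[OF fermat]])
    also have "(2 ^ q) ^ Suc q = (2::nat) ^ n"
      by (simp only: n q mult.commute flip: power_mult)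
    finally show ?thesis .
  qed
  moreover have "coprime (2 ^ p) q"
    by (simp add: q)
  ultimately show ?thesis
    unfolding n by (rule coprime_cong_mult_nat)
qed

end
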